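(* Let $v_1,\dots,v_n\in\mathbb{R}^n$ be linearly independent unit vectors and let $\lambda_1,\dots,\lambda_n$ be positive real numbers. For every real $p\ge 1$, the $(v_1,\dots,v_n)$-Minkowski distance function $d_{p(v_1,\dots,v_n)}$ is a metric on $\mathbb{R}^n$.
   Context: Write $v_i=(v_{i1},\dots,v_{in})$. Unit vectors are unit with respect to the Euclidean norm. For a positive real $p$, the $(v_1,\dots,v_n)$-Minkowski distance function (with fixed weights $\lambda_1,\dots,\lambda_n$) is $d_{p(v_1,\dots,v_n)}:\mathbb{R}^n\times\mathbb{R}^n\to[0,\infty)$, $$d_{p(v_1,\dots,v_n)}(X,Y)=\left(\sum_{i=1}^n\bigl(\lambda_i\,|v_{i1}(x_1-y_1)+\dots+v_{in}(x_n-y_n)|\bigr)^p\right)^{1/p}$$ for $X=(x_1,\dots,x_n)$, $Y=(y_1,\dots,y_n)$. *)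

theory Defs
  imports "HOL-Analysis.Analysis"
begin

definition minkowski_dist ::
  "('n::finite \<Rightarrow> real) \<Rightarrow> ('n \<Rightarrow> real ^ 'n) \<Rightarrow> real \<Rightarrow> real ^ 'n \<Rightarrow> real ^ 'n \<Rightarrow> real"
  where
  "minkowski_dist lam v p X Y =
     (\<Sum>i\<in>UNIV. (lam i * \<bar>\<Sum>j\<in>UNIV. v i $ j * (X $ j - Y $ j)\<bar>) powr p) powr (1 / p)"

text \<open>A family is linearly independent iff it is injective and its range is an independent set;
  injectivity is needed because passing to the range forgets repetitions.\<close>
definition lin_indep_family :: "('i \<Rightarrow> 'a::real_vector) \<Rightarrow> bool" where
  "lin_indep_family v \<longleftrightarrow> inj v \<and> independent (range v)"

end

theory Submission
  imports Defs
begin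

text \<open>The triangle inequality is the finite Minkowski inequality: writing \<open>A\<close> and \<open>B\<close> for the
  \<open>p\<close>-norms of the families \<open>a\<close> and \<open>b\<close>, the quotient \<open>(a i + b i) / (A + B)\<close> is a convex
  combination of \<open>a i / A\<close> and \<open>b i / B\<close> with weights independent of \<open>i\<close>, so convexity of
  \<open>x \<mapsto> x powr p\<close> bounds the sum of its \<open>p\<close>-th powers by 1. Definiteness holds because \<open>n\<close>
  independent vectors span the whole space, so only the zero vector is orthogonal to all of
  them.\<close>

text \<open>Convexity on the open half-line extends to the endpoint 0, which is attained when some
  \<open>a i\<close> or \<open>b i\<close> vanishes. As \<open>0 powr p = 0\<close>, the inequality
  with a zero argument reduces to \<open>scale\<close>, that is, to \<open>s powr p \<le> s\<close>
  for \<open>0 < s < 1\<close>.\<close>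

lemma powr_convex_nonneg:
  fixes p :: real
  assumes "p \<ge> 1"
  shows "convex_on {0..} (\<lambda>x. x powr p)"
proof (rule convex_onI)
  fix t x y :: real
  assume t: "0 < t" "t < 1" and xy: "x \<in> {0..}" "y \<in> {0..}"
  have scale: "(s * z) powr p \<le> s * z powr p" if "0 < s" "s < 1" "0 \<le> z" for s z
  proof -
    have "s powr p \<le> s powr 1"
      using that assms by (intro powr_mono') auto
    with that show ?thesis
      by (simp add: powr_mult mult_right_mono)
  qed
  consider "x = 0" | "y = 0" | "x > 0" "y > 0"
    using xy by force
  then show "((1 - t) *\<^sub>R x + t *\<^sub>R y) powr p \<le> (1 - t) * x powr p + t * y powr p"
  proof cases
    case 3
    then show ?thesis
      using convex_onD[OF powr_convex[OF assms], of t x y] t by simp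
  qed (use scale[of t y] scale[of "1 - t" x] t xy in auto)
qed simp

lemma Minkowski_inequality_sum:
  fixes a b :: "'i \<Rightarrow> real" and p :: real
  assumes "finite I" and p: "p \<ge> 1"
    and a: "\<And>i. i \<in> I \<Longrightarrow> a i \<ge> 0" and b: "\<And>i. i \<in> I \<Longrightarrow> b i \<ge> 0"
  shows "(\<Sum>i\<in>I. (a i + b i) powr p) powr (1 / p)
    \<le> (\<Sum>i\<in>I. a i powr p) powr (1 / p) + (\<Sum>i\<in>I. b i powr p) powr (1 / p)"
proof -
  define A where "A = (\<Sum>i\<in>I. a i powr p) powr (1 / p)"
  define B where "B = (\<Sum>i\<in>I. b i powr p) powr (1 / p)"
  have Ap: "A powr p = (\<Sum>i\<in>I. a i powr p)" and Bp: "B powr p = (\<Sum>i\<in>I. b i powr p)"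
    using p by (auto simp: A_def B_def powr_powr intro!: abs_of_nonneg sum_nonneg)
  have "A \<ge> 0" "B \<ge> 0"
    by (auto simp: A_def B_def)
  \<comment> \<open>Normalizing divides by \<open>A\<close> and \<open>B\<close>. If one of them is
    0, its whole family vanishes and the two sides agree.\<close>
  then consider "A = 0" | "B = 0" | "A > 0" "B > 0"
    by force
  then have "(\<Sum>i\<in>I. (a i + b i) powr p) powr (1 / p) \<le> A + B"
  proof cases
    case 1
    then have "\<forall>i\<in>I. a i = 0"
      using Ap \<open>finite I\<close> by (simp add: sum_nonneg_eq_0_iff)
    then show ?thesis
      using 1 by (simp add: B_def)
  next
    case 2
    then have "\<forall>i\<in>I. b i = 0"
      using Bp \<open>finite I\<close> by (simp add: sum_nonneg_eq_0_iff)
    then show ?thesis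
      using 2 by (simp add: A_def)
  next
    case 3
    \<comment> \<open>With this weight \<open>(A + B) * (1 - t) = A\<close> and
      \<open>(A + B) * t = B\<close>, so the factors \<open>A\<close> and \<open>B\<close> cancel
      the normalization of \<open>a i\<close> and \<open>b i\<close>.\<close>
    define t where "t = B / (A + B)"
    have t: "0 \<le> t" "t \<le> 1"
      using 3 by (auto simp: t_def)
    have one: "1 - t = A / (A + B)"
      using 3 by (simp add: t_def field_simps)
    have "(a i + b i) powr p
        \<le> (A + B) powr p * ((1 - t) * (a i powr p / A powr p) + t * (b i powr p / B powr p))"
      if "i \<in> I" for i
    proof -
      have "a i + b i = (A + B) * ((1 - t) * (a i / A) + t * (b i / B))"
        unfolding one using 3 by (simp add: t_def flip: add_divide_distrib)
      then have "(a i + b i) powr p = (A + B) powr p * ((1 - t) * (a i / A) + t * (b i / B)) powr p"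
        using 3 t a[OF that] b[OF that] by (simp add: powr_mult)
      also have "\<dots> \<le> (A + B) powr p * ((1 - t) * (a i / A) powr p + t * (b i / B) powr p)"
        using convex_onD[OF powr_convex_nonneg[OF p] t, of "a i / A" "b i / B"]
          3 a[OF that] b[OF that]
        by (intro mult_left_mono) auto
      finally show ?thesis
        using 3 a[OF that] b[OF that] by (simp add: powr_divide)
    qed
    then have "(\<Sum>i\<in>I. (a i + b i) powr p)
        \<le> (\<Sum>i\<in>I. (A + B) powr p * ((1 - t) * (a i powr p / A powr p) + t * (b i powr p / B powr p)))"
      by (rule sum_mono)
    \<comment> \<open>By \<open>Ap\<close> and \<open>Bp\<close> the normalized powers sum to 1 for
      each family, and the weights \<open>1 - t\<close> and \<open>t\<close> add up to 1.\<close>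
    also have "\<dots> = (A + B) powr p * ((1 - t) * (A powr p / A powr p) + t * (B powr p / B powr p))"
      by (simp add: Ap Bp sum.distrib flip: sum_distrib_left sum_divide_distrib)
    also have "\<dots> = (A + B) powr p"
      using 3 by simp
    finally have "(\<Sum>i\<in>I. (a i + b i) powr p) powr (1 / p) \<le> ((A + B) powr p) powr (1 / p)"
      using p by (intro powr_mono2 sum_nonneg) auto
    also have "\<dots> = A + B"
      using 3 p by (simp add: powr_powr)
    finally show ?thesis .
  qed
  then show ?thesis
    by (simp add: A_def B_def)
qed

text \<open>By injectivity the range has as many elements as the dimension, so independence makes it
  spanning. Then \<open>x\<close> is orthogonal to every vector, in particular to itself.\<close>

lemma lin_indep_family_orthogonal_eq_0:
  fixes v :: "'n::finite \<Rightarrow> real ^ 'n"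
  assumes "lin_indep_family v" and "\<And>i. v i \<bullet> x = 0"
  shows "x = 0"
proof -
  have "card (range v) = DIM(real ^ 'n)"
    using assms(1) by (simp add: lin_indep_family_def card_image)
  then have "span (range v) = UNIV"
    using assms(1) card_ge_dim_independent[of "range v" UNIV]
    by (auto simp: lin_indep_family_def)
  then have "orthogonal x x"
    using assms(2) by (intro orthogonal_to_span[of x "range v"])
      (auto simp: orthogonal_def inner_commute[of x])
  then show ?thesis
    by (simp add: orthogonal_def)
qed

lemma minkowski_dist_inner:
  "minkowski_dist lam v p X Y = (\<Sum>i\<in>UNIV. (lam i * \<bar>v i \<bullet> (X - Y)\<bar>) powr p) powr (1 / p)"
  by (simp add: minkowski_dist_def inner_vec_def)

theorem theorem2p1:
  fixes v :: "'n::finite \<Rightarrow> real ^ 'n"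
    and lam :: "'n \<Rightarrow> real"
    and p :: real
  assumes "lin_indep_family v"
    and "\<And>i. norm (v i) = 1"
    and "\<And>i. lam i > 0"
    and "p \<ge> 1"
  shows "Metric_space UNIV (minkowski_dist lam v p)"
proof
  fix X Y Z :: "real ^ 'n"
  show "0 \<le> minkowski_dist lam v p X Y"
    by (simp add: minkowski_dist_def)
  show "minkowski_dist lam v p X Y = minkowski_dist lam v p Y X"
    by (simp add: minkowski_dist_inner inner_diff_right abs_minus_commute)
  show "minkowski_dist lam v p X Y = 0 \<longleftrightarrow> X = Y"
  proof
    assume "minkowski_dist lam v p X Y = 0"
    \<comment> \<open>A vanishing sum of nonnegative powers forces every base to be 0.\<close>
    then have "lam i * \<bar>v i \<bullet> (X - Y)\<bar> = 0" for i
      by (simp add: minkowski_dist_inner sum_nonneg_eq_0_iff)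
    then have "v i \<bullet> (X - Y) = 0" for i
      using assms(3)[of i] by (metis abs_eq_0 less_irrefl mult_eq_0_iff)
    then show "X = Y"
      using lin_indep_family_orthogonal_eq_0[OF assms(1), of "X - Y"] by simp
  qed (simp add: minkowski_dist_inner)
  \<comment> \<open>Splitting \<open>X - Z\<close> as \<open>(X - Y) + (Y - Z)\<close> bounds each
    weighted term by \<open>a i + b i\<close>; monotonicity of \<open>powr\<close> then reduces the
    claim to the Minkowski inequality.\<close>
  define a where "a i = lam i * \<bar>v i \<bullet> (X - Y)\<bar>" for i
  define b where "b i = lam i * \<bar>v i \<bullet> (Y - Z)\<bar>" for i
  have nonneg: "a i \<ge> 0" "b i \<ge> 0" for i
    using assms(3)[of i] by (auto simp: a_def b_def)
  have "lam i * \<bar>v i \<bullet> (X - Z)\<bar> \<le> a i + b i" for i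
    unfolding a_def b_def distrib_left[symmetric]
    using assms(3)[of i] by (intro mult_left_mono) (auto simp: inner_diff_right)
  then have "minkowski_dist lam v p X Z \<le> (\<Sum>i\<in>UNIV. (a i + b i) powr p) powr (1 / p)"
    unfolding minkowski_dist_inner using assms(3,4)
    by (intro powr_mono2 sum_mono sum_nonneg) (auto simp: less_imp_le)
  also have "\<dots> \<le> minkowski_dist lam v p X Y + minkowski_dist lam v p Y Z"
    using Minkowski_inequality_sum[of UNIV p a b] assms(4) nonneg
    by (simp add: minkowski_dist_inner a_def b_def)
  finally show "minkowski_dist lam v p X Z \<le> minkowski_dist lam v p X Y + minkowski_dist lam v p Y Z" .
qed

end
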